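(* For every instance with two agents with additive utilities and $m$ items, there exists an allocation that is both Pareto-optimal and EF1, and such an allocation can be computed in $O(m^2)$ time.
   Context: An instance is a triple $I=(N,O,U)$ where $N$ is a finite set of agents (here $|N|=2$), $O=\{o_1,\dots,o_m\}$ is a finite set of indivisible items, and $U$ is a tuple of utility functions $u_i:2^O\to\mathbb{R}$, one for each $i\in N$. Write $u_i(o)=u_i(\{o\})$; utilities may be positive, zero or negative, and the same item may have different signs for different agents. Utilities are additive: $u_i(X)=\sum_{o\in X}u_i(o)$ for every $X\subseteq O$. An allocation is a function $\pi:N\to 2^O$ with $\bigcup_{i\in N}\pi(i)=O$ and $\pi(i)\cap\pi(j)=\emptyset$ for distinct $i,j$. Agent $i$ envies $j$ if $u_i(\pi(i))<u_i(\pi(j))$. Agent $i$ envies $j$ by more than one item if $i$ envies $j$ and $u_i(\pi(i)\setminus\{o\})<u_i(\pi(j)\setminus\{o\})$ for every item $o\in\pi(i)\cup\pi(j)$. The allocation $\pi$ is envy-free up to one item (EF1) if for all $i,j\in N$, $i$ does not envy $j$ by more than one item. An allocation $\pi'$ is a Pareto-improvement of $\pi$ if $u_i(\pi'(i))\ge u_i(\pi(i))$ for all $i\in N$ and $u_j(\pi'(j))>u_j(\pi(j))$ for some $j\in N$; $\pi$ is Pareto-optimal if no allocation is a Pareto-improvement of $\pi$. Running time counts elementary operations (arithmetic operations and comparisons on utility values). *)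

theory Defs
  imports Complex_Main "HOL-Library.Landau_Symbols"
begin

section \<open>Fair division of indivisible items\<close>

definition additive_on :: "'o set \<Rightarrow> ('o set \<Rightarrow> real) \<Rightarrow> bool" where
  "additive_on Os v \<longleftrightarrow> (\<forall>X\<subseteq>Os. v X = (\<Sum>x\<in>X. v {x}))"

text \<open>The value of an allocation outside the set \<open>N\<close> of agents is irrelevant.\<close>

definition allocation :: "'i set \<Rightarrow> 'o set \<Rightarrow> ('i \<Rightarrow> 'o set) \<Rightarrow> bool" where
  "allocation N Os \<pi> \<longleftrightarrow>
     (\<Union>i\<in>N. \<pi> i) = Os \<and> (\<forall>i\<in>N. \<forall>j\<in>N. i \<noteq> j \<longrightarrow> \<pi> i \<inter> \<pi> j = {})"

definition envies :: "('i \<Rightarrow> 'o set \<Rightarrow> real) \<Rightarrow> ('i \<Rightarrow> 'o set) \<Rightarrow> 'i \<Rightarrow> 'i \<Rightarrow> bool" where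
  "envies u \<pi> i j \<longleftrightarrow> u i (\<pi> i) < u i (\<pi> j)"

definition envies_by_more_than_one_item ::
    "('i \<Rightarrow> 'o set \<Rightarrow> real) \<Rightarrow> ('i \<Rightarrow> 'o set) \<Rightarrow> 'i \<Rightarrow> 'i \<Rightarrow> bool" where
  "envies_by_more_than_one_item u \<pi> i j \<longleftrightarrow>
     envies u \<pi> i j \<and> (\<forall>x \<in> \<pi> i \<union> \<pi> j. u i (\<pi> i - {x}) < u i (\<pi> j - {x}))"

definition EF1 :: "'i set \<Rightarrow> ('i \<Rightarrow> 'o set \<Rightarrow> real) \<Rightarrow> ('i \<Rightarrow> 'o set) \<Rightarrow> bool" where
  "EF1 N u \<pi> \<longleftrightarrow> (\<forall>i\<in>N. \<forall>j\<in>N. \<not> envies_by_more_than_one_item u \<pi> i j)"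

definition pareto_improvement ::
    "'i set \<Rightarrow> 'o set \<Rightarrow> ('i \<Rightarrow> 'o set \<Rightarrow> real) \<Rightarrow> ('i \<Rightarrow> 'o set) \<Rightarrow> ('i \<Rightarrow> 'o set) \<Rightarrow> bool" where
  "pareto_improvement N Os u \<pi> \<pi>' \<longleftrightarrow>
     allocation N Os \<pi>' \<and>
     (\<forall>i\<in>N. u i (\<pi>' i) \<ge> u i (\<pi> i)) \<and> (\<exists>j\<in>N. u j (\<pi>' j) > u j (\<pi> j))"

definition pareto_optimal ::
    "'i set \<Rightarrow> 'o set \<Rightarrow> ('i \<Rightarrow> 'o set \<Rightarrow> real) \<Rightarrow> ('i \<Rightarrow> 'o set) \<Rightarrow> bool" where
  "pareto_optimal N Os u \<pi> \<longleftrightarrow> \<not> (\<exists>\<pi>'. pareto_improvement N Os u \<pi> \<pi>')"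


section \<open>A real RAM with unit-cost accounting\<close>

text \<open>
  Programs are finite pieces of syntax, independent of the number of items, over two separate
  kinds of memory: named arrays of natural numbers (counters, addresses, output) and named arrays
  of reals (utility values). A scalar variable is cell 0 of an array. Reals are accessible only
  through exact field operations and comparisons; there is no rounding or conversion from reals
  to naturals, and program constants are integers. Naturals have only addition, (truncated)
  subtraction and comparison, so that unit cost is harmless. Every node of an expression,
  every assignment and every branch costs one unit. So the running time bounds in particular the
  number of arithmetic operations and comparisons on utility values.
\<close>

type_synonym arr = string

record state =
  nmem :: "arr \<Rightarrow> nat \<Rightarrow> nat"
  rmem :: "arr \<Rightarrow> nat \<Rightarrow> real"

datatype nexp =
    NConst nat
  | NCell arr nexp
  | NAdd nexp nexp
  | NSub nexp nexp

datatype rexp =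
    RConst int
  | RCell arr nexp
  | RAdd rexp rexp
  | RSub rexp rexp
  | RMul rexp rexp
  | RDiv rexp rexp

datatype test =
    NLess nexp nexp
  | NEq nexp nexp
  | RLess rexp rexp
  | REq rexp rexp
  | TNot test
  | TAnd test test
  | TOr test test

datatype com =
    Skip
  | NAssign arr nexp nexp
  | RAssign arr nexp rexp
  | Seq com com
  | Cond test com com
  | While test com

fun nval :: "nexp \<Rightarrow> state \<Rightarrow> nat" where
  "nval (NConst k) s = k"
| "nval (NCell a e) s = nmem s a (nval e s)"
| "nval (NAdd e f) s = nval e s + nval f s"
| "nval (NSub e f) s = nval e s - nval f s"

fun rval :: "rexp \<Rightarrow> state \<Rightarrow> real" where
  "rval (RConst k) s = of_int k"
| "rval (RCell a e) s = rmem s a (nval e s)"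
| "rval (RAdd e f) s = rval e s + rval f s"
| "rval (RSub e f) s = rval e s - rval f s"
| "rval (RMul e f) s = rval e s * rval f s"
| "rval (RDiv e f) s = rval e s / rval f s"

fun tval :: "test \<Rightarrow> state \<Rightarrow> bool" where
  "tval (NLess e f) s \<longleftrightarrow> nval e s < nval f s"
| "tval (NEq e f) s \<longleftrightarrow> nval e s = nval f s"
| "tval (RLess e f) s \<longleftrightarrow> rval e s < rval f s"
| "tval (REq e f) s \<longleftrightarrow> rval e s = rval f s"
| "tval (TNot b) s \<longleftrightarrow> \<not> tval b s"
| "tval (TAnd b c) s \<longleftrightarrow> tval b s \<and> tval c s"
| "tval (TOr b c) s \<longleftrightarrow> tval b s \<or> tval c s"

fun ncost :: "nexp \<Rightarrow> nat" where
  "ncost (NConst k) = 1"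
| "ncost (NCell a e) = 1 + ncost e"
| "ncost (NAdd e f) = 1 + ncost e + ncost f"
| "ncost (NSub e f) = 1 + ncost e + ncost f"

fun rcost :: "rexp \<Rightarrow> nat" where
  "rcost (RConst k) = 1"
| "rcost (RCell a e) = 1 + ncost e"
| "rcost (RAdd e f) = 1 + rcost e + rcost f"
| "rcost (RSub e f) = 1 + rcost e + rcost f"
| "rcost (RMul e f) = 1 + rcost e + rcost f"
| "rcost (RDiv e f) = 1 + rcost e + rcost f"

fun tcost :: "test \<Rightarrow> nat" where
  "tcost (NLess e f) = 1 + ncost e + ncost f"
| "tcost (NEq e f) = 1 + ncost e + ncost f"
| "tcost (RLess e f) = 1 + rcost e + rcost f"
| "tcost (REq e f) = 1 + rcost e + rcost f"
| "tcost (TNot b) = 1 + tcost b"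
| "tcost (TAnd b c) = 1 + tcost b + tcost c"
| "tcost (TOr b c) = 1 + tcost b + tcost c"

definition nwrite :: "arr \<Rightarrow> nat \<Rightarrow> nat \<Rightarrow> state \<Rightarrow> state" where
  "nwrite a k x s = s\<lparr>nmem := (nmem s)(a := (nmem s a)(k := x))\<rparr>"

definition rwrite :: "arr \<Rightarrow> nat \<Rightarrow> real \<Rightarrow> state \<Rightarrow> state" where
  "rwrite a k x s = s\<lparr>rmem := (rmem s)(a := (rmem s a)(k := x))\<rparr>"

text \<open>\<open>exec c s t s'\<close>: started in \<open>s\<close>, the program \<open>c\<close> halts in \<open>s'\<close> after exactly \<open>t\<close> units.\<close>

inductive exec :: "com \<Rightarrow> state \<Rightarrow> nat \<Rightarrow> state \<Rightarrow> bool" where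
  Skip: "exec Skip s 1 s"
| NAssign: "exec (NAssign a i e) s (1 + ncost i + ncost e) (nwrite a (nval i s) (nval e s) s)"
| RAssign: "exec (RAssign a i e) s (1 + ncost i + rcost e) (rwrite a (nval i s) (rval e s) s)"
| Seq: "exec c s t s' \<Longrightarrow> exec d s' t' s'' \<Longrightarrow> exec (Seq c d) s (t + t') s''"
| CondTrue: "tval b s \<Longrightarrow> exec c s t s' \<Longrightarrow> exec (Cond b c d) s (1 + tcost b + t) s'"
| CondFalse: "\<not> tval b s \<Longrightarrow> exec d s t s' \<Longrightarrow> exec (Cond b c d) s (1 + tcost b + t) s'"
| WhileFalse: "\<not> tval b s \<Longrightarrow> exec (While b c) s (1 + tcost b) s"
| WhileTrue: "tval b s \<Longrightarrow> exec c s t s' \<Longrightarrow> exec (While b c) s' t' s'' \<Longrightarrow>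
    exec (While b c) s (1 + tcost b + t + t') s''"

inductive_cases exec_cases:
  "exec Skip s t s'"
  "exec (NAssign a i e) s t s'"
  "exec (RAssign a i e) s t s'"
  "exec (Seq c d) s t s'"
  "exec (Cond b c d) s t s'"
  "exec (While b c) s t s'"

text \<open>Execution is deterministic, so claiming that some run exists with a given time bound and
  result is the same as claiming it for the only run.\<close>

lemma exec_deterministic:
  "exec c s t s' \<Longrightarrow> exec c s t' s'' \<Longrightarrow> t' = t \<and> s'' = s'"
proof (induction arbitrary: t' s'' rule: exec.induct)
  case (Seq c s t1 s1 d t2 s2)
  from Seq.prems obtain u1 v1 u2 where
    "exec c s u1 v1" "exec d v1 u2 s''" "t' = u1 + u2"
    by (rule exec_cases(4))
  with Seq.IH show ?case by blast
next
  case (CondTrue b s c t1 s1 d)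
  from CondTrue.prems obtain u1 where "exec c s u1 s''" "t' = 1 + tcost b + u1"
    by (rule exec_cases(5)) (use CondTrue.hyps in simp_all)
  with CondTrue.IH show ?case by blast
next
  case (CondFalse b s d t1 s1 c)
  from CondFalse.prems obtain u1 where "exec d s u1 s''" "t' = 1 + tcost b + u1"
    by (rule exec_cases(5)) (use CondFalse.hyps in simp_all)
  with CondFalse.IH show ?case by blast
next
  case (WhileFalse b s c)
  from WhileFalse.prems show ?case
    by (rule exec_cases(6)) (use WhileFalse.hyps in simp_all)
next
  case (WhileTrue b s c t1 s1 t2 s2)
  from WhileTrue.prems obtain u1 v1 u2 where
    "exec c s u1 v1" "exec (While b c) v1 u2 s''" "t' = 1 + tcost b + u1 + u2"
    by (rule exec_cases(6)) (use WhileTrue.hyps in simp_all)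
  with WhileTrue.IH show ?case by blast
qed (erule exec_cases(1-3); simp)+


section \<open>Input and output of a two-agent allocation program\<close>

text \<open>Here \<open>v k j\<close> is the utility of the \<open>k\<close>-th agent (\<open>k < 2\<close>) for the \<open>j\<close>-th item
  (\<open>j < m\<close>), both counted from 0. All other memory is initially zero.\<close>

definition input_state :: "nat \<Rightarrow> (nat \<Rightarrow> nat \<Rightarrow> real) \<Rightarrow> state" where
  "input_state m v = \<lparr>
     nmem = (\<lambda>a j. if a = ''m'' \<and> j = 0 then m else 0),
     rmem = (\<lambda>a j. if a = ''u0'' \<and> j < m then v 0 j
                   else if a = ''u1'' \<and> j < m then v 1 j else 0)\<rparr>"

text \<open>On halting, cell \<open>j\<close> of the array \<open>''alloc''\<close> is the number of the agent receiving item \<open>j\<close>.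
  An item with an entry other than 0 or 1 is given to nobody, so that the result is then not an
  allocation.\<close>

definition output_allocation ::
    "nat \<Rightarrow> (nat \<Rightarrow> 'i) \<Rightarrow> (nat \<Rightarrow> 'o) \<Rightarrow> state \<Rightarrow> 'i \<Rightarrow> 'o set" where
  "output_allocation m agt itm s i =
     {itm j | j. j < m \<and> nmem s ''alloc'' j < 2 \<and> agt (nmem s ''alloc'' j) = i}"

end

theory Submission imports Defs begin

text \<open>
  Call an item contested if both agents like it or both dislike it; every other item goes to an
  agent who does not mind it. Order the contested items by the ratio of the two utilities and let
  a threshold \<open>t\<close> run through them: contested items before \<open>t\<close> are placed to the advantage of the
  second agent, those after \<open>t\<close> to the advantage of the first. However \<open>t\<close> itself is placed, the
  result maximises the welfare weighted by \<open>(1, ratio of t)\<close>, so it is Pareto-optimal; and even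
  when \<open>t\<close> is left out, the two agents do not envy each other simultaneously, since exchanging the
  bundles would raise the weighted welfare. At the first threshold for which the second agent
  ceases to be envious once \<open>t\<close> is placed to her advantage, the first agent is not envious when \<open>t\<close>
  is placed to his. One of them is not envious without \<open>t\<close>; placing \<open>t\<close> to the advantage of the
  other leaves the other without envy, and the former's envy, if any, disappears on removing \<open>t\<close>.
  The program tries every threshold in linear time.
\<close>

section \<open>Pareto-optimality from weighted welfare\<close>

text \<open>Every item lies with an agent for whom its weighted utility is largest, so
  \<open>\<pi>\<close> maximises the weighted welfare item by item. As all weights are positive, a
  Pareto-improvement would exceed that maximum.\<close>

lemma pareto_optimal_if_weighted:
  fixes w :: "'i \<Rightarrow> real"
  assumes N: "finite N" and Os: "finite Os" and alloc: "allocation N Os \<pi>"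
    and add: "\<And>i. i \<in> N \<Longrightarrow> additive_on Os (u i)"
    and w_pos: "\<And>i. i \<in> N \<Longrightarrow> 0 < w i"
    and best: "\<And>i k x. i \<in> N \<Longrightarrow> k \<in> N \<Longrightarrow> x \<in> \<pi> i \<Longrightarrow> w k * u k {x} \<le> w i * u i {x}"
  shows "pareto_optimal N Os u \<pi>"
proof -
  define M where "M x = Max ((\<lambda>i. w i * u i {x}) ` N)" for x
  have welfare: "(\<Sum>i\<in>N. w i * u i (\<rho> i)) = (\<Sum>i\<in>N. \<Sum>x\<in>\<rho> i. w i * u i {x})"
    and total: "(\<Sum>i\<in>N. \<Sum>x\<in>\<rho> i. M x) = (\<Sum>x\<in>Os. M x)" if "allocation N Os \<rho>" for \<rho>
  proof -
    have sub: "\<rho> i \<subseteq> Os" if "i \<in> N" for i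
      using that \<open>allocation N Os \<rho>\<close> unfolding allocation_def by blast
    have "u i (\<rho> i) = (\<Sum>x\<in>\<rho> i. u i {x})" if "i \<in> N" for i
      using add[OF that] sub[OF that] unfolding additive_on_def by blast
    then show "(\<Sum>i\<in>N. w i * u i (\<rho> i)) = (\<Sum>i\<in>N. \<Sum>x\<in>\<rho> i. w i * u i {x})"
      by (simp add: sum_distrib_left)
    have "(\<Sum>x\<in>(\<Union>i\<in>N. \<rho> i). M x) = (\<Sum>i\<in>N. \<Sum>x\<in>\<rho> i. M x)"
      using \<open>allocation N Os \<rho>\<close> N Os sub
      by (intro sum.UNION_disjoint) (auto simp: allocation_def intro: finite_subset)
    then show "(\<Sum>i\<in>N. \<Sum>x\<in>\<rho> i. M x) = (\<Sum>x\<in>Os. M x)"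
      using \<open>allocation N Os \<rho>\<close> by (simp add: allocation_def)
  qed
  have M_eq: "w i * u i {x} = M x" if "i \<in> N" "x \<in> \<pi> i" for i x
    unfolding M_def using that N best by (intro Max_eqI[symmetric]) auto
  have M_ge: "w i * u i {x} \<le> M x" if "i \<in> N" for i x
    unfolding M_def using that N by (intro Max_ge) auto
  have "\<not> pareto_improvement N Os u \<pi> \<rho>" for \<rho>
  proof
    assume imp: "pareto_improvement N Os u \<pi> \<rho>"
    then have \<rho>: "allocation N Os \<rho>"
      by (simp add: pareto_improvement_def)
    have "(\<Sum>i\<in>N. w i * u i (\<rho> i)) \<le> (\<Sum>i\<in>N. \<Sum>x\<in>\<rho> i. M x)"
      unfolding welfare[OF \<rho>] by (intro sum_mono M_ge)
    also have "\<dots> = (\<Sum>i\<in>N. \<Sum>x\<in>\<pi> i. M x)"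
      by (simp add: total \<rho> alloc)
    also have "\<dots> = (\<Sum>i\<in>N. w i * u i (\<pi> i))"
      unfolding welfare[OF alloc] by (simp add: M_eq)
    also have "\<dots> < (\<Sum>i\<in>N. w i * u i (\<rho> i))"
      using imp w_pos N unfolding pareto_improvement_def
      by (intro sum_strict_mono_ex1) (auto simp: less_imp_le)
    finally show False
      by simp
  qed
  then show ?thesis
    by (simp add: pareto_optimal_def)
qed

section \<open>Threshold allocations\<close>

locale two_agents =
  fixes m :: nat and v :: "nat \<Rightarrow> nat \<Rightarrow> real"
begin

text \<open>The sign turns envy into a sum: over all items it is the value of agent
  \<open>k\<close>'s own bundle minus that of the other bundle, so a nonnegative sum means no
  envy.\<close>

definition advantage :: "(nat \<Rightarrow> nat) \<Rightarrow> nat \<Rightarrow> nat \<Rightarrow> real" where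
  "advantage c k j = (if c j = k then v k j else - v k j)"

text \<open>The second conjunct says that no item is misplaced for the weights 1 and
  \<open>r\<close>, which yields Pareto-optimality; the third is freedom from envy after removing at
  most one item.\<close>

definition fair :: "(nat \<Rightarrow> nat) \<Rightarrow> bool" where
  "fair c \<longleftrightarrow> (\<forall>j<m. c j < 2) \<and>
     (\<exists>r>0. \<forall>j<m. 0 \<le> advantage c 0 j + r * advantage c 1 j) \<and>
     (\<forall>k<2. 0 \<le> (\<Sum>j<m. advantage c k j) \<or>
        (\<exists>t<m. 0 \<le> (\<Sum>j\<in>{..<m} - {t}. advantage c k j)))"

text \<open>Needed because the output array is known only on the cells below
  \<open>m\<close>.\<close>

lemma fair_cong:
  assumes "\<And>j. j < m \<Longrightarrow> c j = c' j"
  shows "fair c = fair c'"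
proof -
  have adv: "advantage c k j = advantage c' k j" if "j < m" for k j
    using assms[OF that] by (simp add: advantage_def)
  have "(\<Sum>j\<in>J. advantage c k j) = (\<Sum>j\<in>J. advantage c' k j)" if "J \<subseteq> {..<m}" for k J
    using that adv by (intro sum.cong) auto
  from this[of "{..<m}"] this[of "{..<m} - {t}" for t] show ?thesis
    using assms adv by (simp add: fair_def)
qed

section \<open>Contested items and their placement by a threshold\<close>

definition contested :: "nat \<Rightarrow> bool" where
  "contested j \<longleftrightarrow> 0 < v 0 j * v 1 j"

text \<open>Ties are broken by index, so that the order is strict and total.\<close>

definition before :: "nat \<Rightarrow> nat \<Rightarrow> bool" where
  "before j t \<longleftrightarrow> v 0 j / v 1 j < v 0 t / v 1 t \<or> v 0 j / v 1 j = v 0 t / v 1 t \<and> j < t"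

text \<open>\<open>A\<close> is the set of items that, if contested, are placed to the advantage of agent 1.\<close>

definition owner :: "nat set \<Rightarrow> nat \<Rightarrow> nat" where
  "owner A j = (if (if contested j then 0 < v 0 j \<longleftrightarrow> j \<notin> A else v 1 j < v 0 j) then 0 else 1)"

lemma owner_less_2: "owner A j < 2"
  by (simp add: owner_def)

text \<open>The values of an uncontested item share no strict sign, so the larger is nonnegative and
  the smaller nonpositive; giving the item to the agent with the larger value harms neither.\<close>

lemma advantage_owner_0:
  "advantage (owner A) 0 j = (if contested j \<and> j \<in> A then - \<bar>v 0 j\<bar> else \<bar>v 0 j\<bar>)"
  by (auto simp: advantage_def owner_def contested_def zero_less_mult_iff split: if_splits)

lemma advantage_owner_1:
  "advantage (owner A) 1 j = (if contested j \<and> j \<notin> A then - \<bar>v 1 j\<bar> else \<bar>v 1 j\<bar>)"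
  by (auto simp: advantage_def owner_def contested_def zero_less_mult_iff split: if_splits)

lemma owner_cong: "(contested j \<Longrightarrow> j \<in> A \<longleftrightarrow> j \<in> B) \<Longrightarrow> owner A j = owner B j"
  by (auto simp: owner_def)

lemma advantage_owner_cong:
  "(contested j \<Longrightarrow> j \<in> A \<longleftrightarrow> j \<in> B) \<Longrightarrow> advantage (owner A) k j = advantage (owner B) k j"
  by (simp add: advantage_def owner_cong[of j A B])

lemma ratio_contested:
  assumes "contested j"
  shows "0 < v 0 j / v 1 j" "\<bar>v 0 j\<bar> = v 0 j / v 1 j * \<bar>v 1 j\<bar>"
  using assms by (auto simp: contested_def zero_less_mult_iff zero_less_divide_iff)

text \<open>For contested \<open>j\<close> the sum is the difference of the ratios of
  \<open>j\<close> and \<open>t\<close>, times the absolute value of \<open>v 1 j\<close>, with the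
  sign set by the side on which \<open>j\<close> is placed. At \<open>j = t\<close> it vanishes, so
  both choices of \<open>A\<close> work.\<close>

lemma weighted_advantage_nonneg:
  assumes t: "contested t" and A: "A = {j. before j t} \<or> A = insert t {j. before j t}"
  shows "0 \<le> advantage (owner A) 0 j + v 0 t / v 1 t * advantage (owner A) 1 j"
proof (cases "contested j")
  case True
  define r where "r = v 0 t / v 1 t"
  define q where "q = v 0 j / v 1 j"
  have "j \<in> A \<Longrightarrow> q \<le> r" "j \<notin> A \<Longrightarrow> r \<le> q"
    using A by (auto simp: before_def q_def r_def)
  then have "j \<in> A \<Longrightarrow> q * \<bar>v 1 j\<bar> \<le> r * \<bar>v 1 j\<bar>" "j \<notin> A \<Longrightarrow> r * \<bar>v 1 j\<bar> \<le> q * \<bar>v 1 j\<bar>"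
    by (simp_all add: mult_right_mono)
  moreover have "\<bar>v 0 j\<bar> = q * \<bar>v 1 j\<bar>"
    using ratio_contested(2)[OF True] by (simp add: q_def)
  ultimately show ?thesis
    unfolding advantage_owner_0 advantage_owner_1 r_def[symmetric] using True by simp
next
  case False
  have "0 \<le> v 0 t / v 1 t * \<bar>v 1 j\<bar>"
    using ratio_contested(1)[OF t] by (intro mult_nonneg_nonneg) auto
  then show ?thesis
    unfolding advantage_owner_0 advantage_owner_1 using False by simp
qed

text \<open>Two negative sums would make the weighted sum negative. The set \<open>J\<close> is left
  open to allow sums with and without the threshold item.\<close>

lemma not_both_envious:
  assumes "0 < r" "\<And>j. j \<in> J \<Longrightarrow> 0 \<le> advantage c 0 j + r * advantage c 1 j"
  shows "0 \<le> (\<Sum>j\<in>J. advantage c 0 j) \<or> 0 \<le> (\<Sum>j\<in>J. advantage c 1 j)"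
proof -
  have "0 \<le> (\<Sum>j\<in>J. advantage c 0 j) + r * (\<Sum>j\<in>J. advantage c 1 j)"
    using sum_nonneg[of J "\<lambda>j. advantage c 0 j + r * advantage c 1 j"] assms(2)
    by (simp add: sum.distrib sum_distrib_left)
  then show ?thesis
    using assms(1) by (smt (verit) mult_pos_neg)
qed

section \<open>Accepted thresholds\<close>

definition rest :: "nat \<Rightarrow> nat \<Rightarrow> real" where
  "rest t k = (\<Sum>j\<in>{..<m} - {t}. advantage (owner {j. before j t}) k j)"

text \<open>Item \<open>t\<close> goes to the advantage of agent 0, who must then be free of envy,
  while agent 1 must be so once \<open>t\<close> is removed. In \<open>accept1\<close> the roles are
  exchanged.\<close>

definition accept0 :: "nat \<Rightarrow> bool" where
  "accept0 t \<longleftrightarrow> contested t \<and> 0 \<le> rest t 0 + \<bar>v 0 t\<bar> \<and> 0 \<le> rest t 1"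

definition accept1 :: "nat \<Rightarrow> bool" where
  "accept1 t \<longleftrightarrow> contested t \<and> 0 \<le> rest t 0 \<and> 0 \<le> rest t 1 + \<bar>v 1 t\<bar>"

lemma not_before_self: "\<not> before t t"
  by (simp add: before_def)

text \<open>The two owner maps differ at most at \<open>t\<close>, which the sum omits; hence the
  same sums serve both acceptance conditions.\<close>

lemma rest_insert:
  "rest t k = (\<Sum>j\<in>{..<m} - {t}. advantage (owner (insert t {j. before j t})) k j)"
  unfolding rest_def by (intro sum.cong refl advantage_owner_cong) auto

lemma sum_advantage_0_before:
  "t < m \<Longrightarrow> (\<Sum>j<m. advantage (owner {j. before j t}) 0 j) = rest t 0 + \<bar>v 0 t\<bar>"
  by (subst sum.remove[of _ t]) (simp_all add: rest_def advantage_owner_0 not_before_self)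

lemma sum_advantage_1_insert:
  "t < m \<Longrightarrow> (\<Sum>j<m. advantage (owner (insert t {j. before j t})) 1 j) = rest t 1 + \<bar>v 1 t\<bar>"
  by (subst sum.remove[of _ t]) (simp_all add: rest_insert advantage_owner_1 del: One_nat_def)

lemma fair_accept0:
  assumes "t < m" "accept0 t"
  shows "fair (owner {j. before j t})"
  unfolding fair_def
proof (intro conjI)
  show "\<exists>r>0. \<forall>j<m. 0 \<le> advantage (owner {j. before j t}) 0 j
      + r * advantage (owner {j. before j t}) 1 j"
    using assms weighted_advantage_nonneg ratio_contested(1) unfolding accept0_def by blast
  show "\<forall>k<2. 0 \<le> (\<Sum>j<m. advantage (owner {j. before j t}) k j) \<or>
      (\<exists>t'<m. 0 \<le> (\<Sum>j\<in>{..<m} - {t'}. advantage (owner {j. before j t}) k j))"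
    using assms sum_advantage_0_before unfolding accept0_def rest_def
    by (auto simp: less_2_cases_iff)
qed (simp add: owner_less_2)

lemma fair_accept1:
  assumes "t < m" "accept1 t"
  shows "fair (owner (insert t {j. before j t}))"
  unfolding fair_def
proof (intro conjI)
  show "\<exists>r>0. \<forall>j<m. 0 \<le> advantage (owner (insert t {j. before j t})) 0 j
      + r * advantage (owner (insert t {j. before j t})) 1 j"
    using assms weighted_advantage_nonneg ratio_contested(1) unfolding accept1_def by blast
  show "\<forall>k<2. 0 \<le> (\<Sum>j<m. advantage (owner (insert t {j. before j t})) k j) \<or>
      (\<exists>t'<m. 0 \<le> (\<Sum>j\<in>{..<m} - {t'}. advantage (owner (insert t {j. before j t})) k j))"
    using assms sum_advantage_1_insert unfolding accept1_def rest_insert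
    by (auto simp: less_2_cases_iff)
qed (simp add: owner_less_2)

text \<open>Every advantage is nonnegative, so weight 1 works and no item has to be removed. This
  covers the instances that offer no threshold.\<close>

lemma fair_uncontested:
  assumes "\<And>j. j < m \<Longrightarrow> \<not> contested j"
  shows "fair (owner A)"
proof -
  have "0 \<le> advantage (owner A) k j" if "j < m" "k < 2" for j k
    using that assms by (auto simp: less_2_cases_iff advantage_owner_0 advantage_owner_1[simplified])
  then show ?thesis
    by (auto simp: fair_def owner_less_2 intro!: exI[of _ 1] sum_nonneg)
qed

lemma exists_accepted:
  assumes "j0 < m" "contested j0"
  shows "\<exists>t<m. accept0 t \<or> accept1 t"
proof -
  define S where "S = {j. j < m \<and> contested j}"
  have finS: "finite S" and "S \<noteq> {}"
    using assms by (auto simp: S_def)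
  have asym: "asymp_on X before" and trans: "transp_on X before" for X
    by (auto simp: before_def asymp_on_def transp_on_def)
  have total: "before i j \<or> before j i \<or> i = j" for i j
    by (auto simp: before_def)
  have before_trans: "before i j \<Longrightarrow> before j k \<Longrightarrow> before i k" for i j k
    by (auto simp: before_def)
  \<comment> \<open>The thresholds at which agent 1 is not envious with \<open>t\<close> placed to
    her advantage; the first of them will be accepted.\<close>
  define B where "B = {t \<in> S. 0 \<le> rest t 1 + \<bar>v 1 t\<bar>}"
  obtain l where l: "l \<in> S" "\<And>j. j \<in> S \<Longrightarrow> j \<noteq> l \<Longrightarrow> \<not> before l j"
    using Finite_Set.bex_max_element[OF finS asym trans \<open>S \<noteq> {}\<close>] by blast
  \<comment> \<open>With the last contested item as threshold, all contested items favour agent 1,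
    so \<open>B\<close> is nonempty.\<close>
  have "0 \<le> (\<Sum>j<m. advantage (owner (insert l {j. before j l})) 1 j)"
  proof (intro sum_nonneg)
    fix j assume "j \<in> {..<m}"
    then have "contested j \<Longrightarrow> j = l \<or> before j l"
      using l(2)[of j] total[of j l] by (auto simp: S_def)
    then show "0 \<le> advantage (owner (insert l {j. before j l})) 1 j"
      by (auto simp: advantage_owner_1[simplified])
  qed
  then have "l \<in> B"
    using l(1) sum_advantage_1_insert[of l] by (simp add: B_def S_def)
  moreover have "finite B"
    using finS by (simp add: B_def)
  ultimately obtain t where t: "t \<in> B" "\<And>j. j \<in> B \<Longrightarrow> j \<noteq> t \<Longrightarrow> \<not> before j t"
    using Finite_Set.bex_min_element[OF _ asym trans, of B] by blast
  then have tS: "t < m" "contested t"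
    by (auto simp: B_def S_def)
  note weighted = weighted_advantage_nonneg[OF tS(2) disjI1[OF refl]]
    and weight = ratio_contested(1)[OF tS(2)]
  have nonneg0: "0 \<le> rest t 0 + \<bar>v 0 t\<bar>"
  proof (cases "\<exists>j\<in>S. before j t")
    case False
    then have "0 \<le> (\<Sum>j<m. advantage (owner {j. before j t}) 0 j)"
      by (intro sum_nonneg) (auto simp: advantage_owner_0 S_def)
    then show ?thesis
      by (simp add: sum_advantage_0_before tS(1))
  next
    case True
    then obtain p where p: "p \<in> S" "before p t"
      and p_max: "\<And>j. j \<in> S \<Longrightarrow> before j t \<Longrightarrow> j \<noteq> p \<Longrightarrow> \<not> before p j"
      using Finite_Set.bex_max_element[OF _ asym trans, of "{j\<in>S. before j t}"] finS by auto
    \<comment> \<open>No contested item lies strictly between the predecessor \<open>p\<close> and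
      \<open>t\<close>, so both maps give the same placement. As \<open>p\<close> is not in
      \<open>B\<close>, agent 1 is envious there, and then agent 0 is not.\<close>
    have "advantage (owner {j. before j t}) 1 j = advantage (owner (insert p {j. before j p})) 1 j"
      if "j < m" for j
      using that p p_max[of j] total[of j p] before_trans[of j p t]
      by (intro advantage_owner_cong) (auto simp: S_def)
    then have "(\<Sum>j<m. advantage (owner {j. before j t}) 1 j) = rest p 1 + \<bar>v 1 p\<bar>"
      using p(1) sum_advantage_1_insert[of p] by (simp add: S_def)
    moreover have "p \<notin> B"
      using t(2)[of p] p(2) not_before_self by blast
    ultimately have "(\<Sum>j<m. advantage (owner {j. before j t}) 1 j) < 0"
      using p(1) by (simp add: B_def)
    then show ?thesis
      using not_both_envious[OF weight weighted, of "{..<m}"]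
      by (simp add: sum_advantage_0_before tS(1))
  qed
  \<comment> \<open>Whoever is free of envy without \<open>t\<close> can yield it: the second case
    gives \<open>accept0\<close>, the first \<open>accept1\<close>.\<close>
  have "0 \<le> rest t 0 \<or> 0 \<le> rest t 1"
    unfolding rest_def by (rule not_both_envious[OF weight weighted])
  then have "accept0 t \<or> accept1 t"
    using nonneg0 t(1) tS(2) by (auto simp: accept0_def accept1_def B_def)
  then show ?thesis
    using tS(1) by blast
qed

end

section \<open>Running time bounds\<close>

text \<open>Total correctness with a time budget: termination is part of the claim, since a run has
  to exist.\<close>

definition runs :: "com \<Rightarrow> state \<Rightarrow> nat \<Rightarrow> (state \<Rightarrow> bool) \<Rightarrow> bool" where
  "runs c s T Q \<longleftrightarrow> (\<exists>t s'. exec c s t s' \<and> t \<le> T \<and> Q s')"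

lemma runs_mono: "runs c s T Q \<Longrightarrow> T \<le> T' \<Longrightarrow> (\<And>s'. Q s' \<Longrightarrow> Q' s') \<Longrightarrow> runs c s T' Q'"
  unfolding runs_def by (meson le_trans)

lemma runs_Seq:
  assumes "runs c s T P" "\<And>s'. P s' \<Longrightarrow> runs d s' T' Q"
  shows "runs (Seq c d) s (T + T') Q"
  using assms unfolding runs_def by (meson add_mono exec.Seq)

text \<open>The index of the invariant counts finished rounds and is below \<open>n\<close> whenever
  a round starts, so there are at most \<open>n\<close> rounds; \<open>Suc n\<close> pays for the
  final failing test.\<close>

lemma runs_While:
  assumes init: "I 0 s"
    and step: "\<And>k s. I k s \<Longrightarrow> tval b s \<Longrightarrow> k < n \<and> runs c s T (I (Suc k))"
  shows "runs (While b c) s (Suc n * (1 + tcost b + T)) (\<lambda>s'. \<exists>k. I k s' \<and> \<not> tval b s')"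
proof -
  have "runs (While b c) s (Suc (n - k) * (1 + tcost b + T)) (\<lambda>s'. \<exists>k. I k s' \<and> \<not> tval b s')"
    if "I k s" for k s
    using that
  proof (induction "n - k" arbitrary: k s rule: less_induct)
    case less
    show ?case
    proof (cases "tval b s")
      case False
      then show ?thesis
        using less.prems unfolding runs_def by (fastforce intro: WhileFalse)
    next
      case True
      from step[OF less.prems True] obtain t s' where
        k: "k < n" and s': "exec c s t s'" "t \<le> T" "I (Suc k) s'"
        unfolding runs_def by blast
      have "n - Suc k < n - k"
        using k by simp
      from less.hyps[OF this s'(3)] obtain t' s'' where
        s'': "exec (While b c) s' t' s''" "t' \<le> Suc (n - Suc k) * (1 + tcost b + T)"
          "\<exists>k. I k s'' \<and> \<not> tval b s''"
        unfolding runs_def by blast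
      have "Suc (n - k) = Suc (Suc (n - Suc k))"
        using k by simp
      then have "1 + tcost b + t + t' \<le> Suc (n - k) * (1 + tcost b + T)"
        using s'(2) s''(2) by simp
      then show ?thesis
        using WhileTrue[OF True s'(1) s''(1)] s''(3) unfolding runs_def by blast
    qed
  qed
  from this[of 0 s] init show ?thesis
    by simp
qed

section \<open>Straight-line code\<close>

fun loop_free :: "com \<Rightarrow> bool" where
  "loop_free (Seq c d) \<longleftrightarrow> loop_free c \<and> loop_free d"
| "loop_free (Cond b c d) \<longleftrightarrow> loop_free c \<and> loop_free d"
| "loop_free (While b c) \<longleftrightarrow> False"
| "loop_free _ \<longleftrightarrow> True"

text \<open>A functional semantics that the simplifier can evaluate; the value on loops is a
  dummy.\<close>

fun result :: "com \<Rightarrow> state \<Rightarrow> state" where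
  "result (NAssign a i e) s = nwrite a (nval i s) (nval e s) s"
| "result (RAssign a i e) s = rwrite a (nval i s) (rval e s) s"
| "result (Seq c d) s = result d (result c s)"
| "result (Cond b c d) s = (if tval b s then result c s else result d s)"
| "result _ s = s"

text \<open>Both branches are added: a crude bound, but independent of the state.\<close>

fun max_cost :: "com \<Rightarrow> nat" where
  "max_cost (NAssign a i e) = 1 + ncost i + ncost e"
| "max_cost (RAssign a i e) = 1 + ncost i + rcost e"
| "max_cost (Seq c d) = max_cost c + max_cost d"
| "max_cost (Cond b c d) = 1 + tcost b + max_cost c + max_cost d"
| "max_cost _ = 1"

lemma runs_loop_free: "loop_free c \<Longrightarrow> runs c s (max_cost c) (\<lambda>s'. s' = result c s)"
proof (induction c arbitrary: s)
  case (Seq c d)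
  then show ?case
    by (auto intro!: runs_Seq)
next
  case (Cond b c d)
  show ?case
  proof (cases "tval b s")
    case True
    obtain t where "exec c s t (result c s)" "t \<le> max_cost c"
      using Cond unfolding runs_def by auto
    then show ?thesis
      using CondTrue[OF True] True unfolding runs_def by fastforce
  next
    case False
    obtain t where "exec d s t (result d s)" "t \<le> max_cost d"
      using Cond unfolding runs_def by auto
    then show ?thesis
      using CondFalse[OF False] False unfolding runs_def by fastforce
  qed
qed (use exec.Skip exec.NAssign exec.RAssign in \<open>fastforce simp: runs_def\<close>)+

lemma mem_write [simp]:
  "nmem (nwrite a k x s) = (nmem s)(a := (nmem s a)(k := x))"
  "rmem (nwrite a k x s) = rmem s"
  "rmem (rwrite a k y s) = (rmem s)(a := (rmem s a)(k := y))"
  "nmem (rwrite a k y s) = nmem s"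
  by (simp_all add: nwrite_def rwrite_def)

section \<open>The program\<close>

abbreviation nvar :: "arr \<Rightarrow> nexp" where
  "nvar a \<equiv> NCell a (NConst 0)"

abbreviation rvar :: "arr \<Rightarrow> rexp" where
  "rvar a \<equiv> RCell a (NConst 0)"

definition contested_test :: "nexp \<Rightarrow> test" where
  "contested_test i = RLess (RConst 0) (RMul (RCell ''u0'' i) (RCell ''u1'' i))"

definition before_test :: "nexp \<Rightarrow> nexp \<Rightarrow> test" where
  "before_test i k =
     (let p = RDiv (RCell ''u0'' i) (RCell ''u1'' i); q = RDiv (RCell ''u0'' k) (RCell ''u1'' k)
      in TOr (RLess p q) (TAnd (REq p q) (NLess i k)))"

definition owner_0_test :: test where
  "owner_0_test =
     (let j = nvar ''j'';
          liked = RLess (RConst 0) (RCell ''u0'' j);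
          early = before_test j (nvar ''t'')
      in TOr
          (TAnd (contested_test j)
            (TOr (TAnd liked (TNot early)) (TAnd (TNot liked) early)))
          (TAnd (TNot (contested_test j)) (RLess (RCell ''u1'' j) (RCell ''u0'' j))))"

text \<open>The owner's value is added to the owner's running sum and the other agent's value
  subtracted from the other sum. Item \<open>t\<close> is placed but not counted, so the sums end as
  \<open>rest\<close>.\<close>

definition place_item :: com where
  "place_item =
     Seq
       (Cond owner_0_test
         (Seq (NAssign ''alloc'' (nvar ''j'') (NConst 0))
           (Cond (NEq (nvar ''j'') (nvar ''t'')) Skip
             (Seq (RAssign ''d0'' (NConst 0) (RAdd (rvar ''d0'') (RCell ''u0'' (nvar ''j''))))
                  (RAssign ''d1'' (NConst 0) (RSub (rvar ''d1'') (RCell ''u1'' (nvar ''j'')))))))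
         (Seq (NAssign ''alloc'' (nvar ''j'') (NConst 1))
           (Cond (NEq (nvar ''j'') (nvar ''t'')) Skip
             (Seq (RAssign ''d0'' (NConst 0) (RSub (rvar ''d0'') (RCell ''u0'' (nvar ''j''))))
                  (RAssign ''d1'' (NConst 0) (RAdd (rvar ''d1'') (RCell ''u1'' (nvar ''j''))))))))
       (NAssign ''j'' (NConst 0) (NAdd (nvar ''j'') (NConst 1)))"

definition reset :: com where
  "reset =
     Seq (RAssign ''d0'' (NConst 0) (RConst 0))
       (Seq (RAssign ''d1'' (NConst 0) (RConst 0))
         (NAssign ''j'' (NConst 0) (NConst 0)))"

definition nonneg_test :: "rexp \<Rightarrow> test" where
  "nonneg_test e = TNot (RLess e (RConst 0))"

text \<open>The larger of \<open>d + e\<close> and \<open>d - e\<close> is \<open>d\<close> plus the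
  absolute value of \<open>e\<close>, an operation that expressions do not offer.\<close>

definition nonneg_abs_test :: "rexp \<Rightarrow> rexp \<Rightarrow> test" where
  "nonneg_abs_test d e = TOr (nonneg_test (RAdd d e)) (nonneg_test (RSub d e))"

text \<open>The array holds the placement with \<open>t\<close> to the advantage of agent 0: the
  first test keeps it, the second hands \<open>t\<close> to the other agent.\<close>

definition decide :: com where
  "decide =
     Seq
       (Cond (contested_test (nvar ''t''))
         (Cond (TAnd (nonneg_abs_test (rvar ''d0'') (RCell ''u0'' (nvar ''t'')))
                     (nonneg_test (rvar ''d1'')))
           (NAssign ''found'' (NConst 0) (NConst 1))
           (Cond (TAnd (nonneg_test (rvar ''d0''))
                       (nonneg_abs_test (rvar ''d1'') (RCell ''u1'' (nvar ''t''))))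
             (Seq (NAssign ''found'' (NConst 0) (NConst 1))
               (NAssign ''alloc'' (nvar ''t'')
                 (NSub (NConst 1) (NCell ''alloc'' (nvar ''t'')))))
             Skip))
         Skip)
       (NAssign ''t'' (NConst 0) (NAdd (nvar ''t'') (NConst 1)))"

definition place_test :: test where
  "place_test = NLess (nvar ''j'') (nvar ''m'')"

definition search_test :: test where
  "search_test = TAnd (NLess (nvar ''t'') (nvar ''m'')) (NEq (nvar ''found'') (NConst 0))"

definition try_threshold :: com where
  "try_threshold = Seq reset (Seq (While place_test place_item) decide)"

definition threshold_search :: com where
  "threshold_search = While search_test try_threshold"

definition try_time :: "nat \<Rightarrow> nat" where
  "try_time m =
     max_cost reset + (Suc m * (1 + tcost place_test + max_cost place_item) + max_cost decide)"

definition search_time :: "nat \<Rightarrow> nat" where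
  "search_time m = Suc m * (1 + tcost search_test + try_time m)"

lemma search_time_bigo: "(\<lambda>m. real (search_time m)) \<in> O(\<lambda>m. real m ^ 2)"
proof -
  \<comment> \<open>\<open>p\<close> is the fixed cost of an outer round and \<open>q\<close> the
    cost of an inner one; for positive \<open>m\<close> each factor \<open>Suc m\<close> is at most
    \<open>2 * m\<close>.\<close>
  define p where "p = 1 + tcost search_test + max_cost reset + max_cost decide"
  define q where "q = 1 + tcost place_test + max_cost place_item"
  have bound: "search_time m \<le> (2 * p + 4 * q) * m ^ 2" if "m > 0" for m
  proof -
    have "search_time m = p * Suc m + q * (Suc m * Suc m)"
      unfolding search_time_def try_time_def p_def q_def by (simp only: algebra_simps)
    also have "\<dots> \<le> p * (2 * m ^ 2) + q * ((2 * m) * (2 * m))"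
      using that by (intro add_mono mult_mono) (auto simp: power2_eq_square Suc_le_eq intro: less_le_trans)
    also have "\<dots> = (2 * p + 4 * q) * m ^ 2"
      by (simp add: algebra_simps power2_eq_square)
    finally show ?thesis .
  qed
  show ?thesis
  proof (rule bigoI)
    show "\<forall>\<^sub>F m in sequentially. norm (real (search_time m))
        \<le> real (2 * p + 4 * q) * norm (real m ^ 2)"
      using eventually_gt_at_top[of 0]
    proof eventually_elim
      case (elim m)
      then show ?case
        using of_nat_mono[OF bound[OF elim], where 'a = real]
        by (simp only: of_nat_mult of_nat_power real_norm_def abs_power2)
    qed
  qed
qed

lemma result_place_item:
  assumes "nmem s ''t'' 0 = t" "nmem s ''j'' 0 = k"
  shows "nmem (result place_item s) = (nmem s)
      (''alloc'' := (nmem s ''alloc'')(k := if tval owner_0_test s then 0 else 1),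
       ''j'' := (nmem s ''j'')(0 := Suc k))"
    and "rmem (result place_item s) =
      (if k = t then rmem s
       else if tval owner_0_test s
       then (rmem s)(''d0'' := (rmem s ''d0'')(0 := rmem s ''d0'' 0 + rmem s ''u0'' k),
                     ''d1'' := (rmem s ''d1'')(0 := rmem s ''d1'' 0 - rmem s ''u1'' k))
       else (rmem s)(''d0'' := (rmem s ''d0'')(0 := rmem s ''d0'' 0 - rmem s ''u0'' k),
                     ''d1'' := (rmem s ''d1'')(0 := rmem s ''d1'' 0 + rmem s ''u1'' k)))"
  using assms by (simp_all add: place_item_def)

section \<open>Correctness of the program\<close>

context two_agents
begin

definition holds_input :: "state \<Rightarrow> bool" where
  "holds_input s \<longleftrightarrow> nmem s ''m'' 0 = m \<and>
     (\<forall>j<m. rmem s ''u0'' j = v 0 j) \<and> (\<forall>j<m. rmem s ''u1'' j = v 1 j)"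

definition place_inv :: "nat \<Rightarrow> nat \<Rightarrow> state \<Rightarrow> bool" where
  "place_inv t k s \<longleftrightarrow> holds_input s \<and> k \<le> m \<and> nmem s ''t'' 0 = t \<and> nmem s ''j'' 0 = k \<and>
     nmem s ''found'' 0 = 0 \<and> (\<forall>j<k. nmem s ''alloc'' j = owner {j. before j t} j) \<and>
     rmem s ''d0'' 0 = (\<Sum>j\<in>{..<k} - {t}. advantage (owner {j. before j t}) 0 j) \<and>
     rmem s ''d1'' 0 = (\<Sum>j\<in>{..<k} - {t}. advantage (owner {j. before j t}) 1 j)"

text \<open>Until a threshold is found, the array keeps the placement for the last one tried, hence
  \<open>k - 1\<close>; this becomes the output if all are refused.\<close>

definition search_inv :: "nat \<Rightarrow> state \<Rightarrow> bool" where
  "search_inv k s \<longleftrightarrow> holds_input s \<and> k \<le> m \<and> nmem s ''t'' 0 = k \<and>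
     (if nmem s ''found'' 0 = 0
      then (\<forall>t<k. \<not> accept0 t \<and> \<not> accept1 t) \<and>
        (k > 0 \<longrightarrow> (\<forall>j<m. nmem s ''alloc'' j = owner {j. before j (k - 1)} j))
      else fair (nmem s ''alloc''))"

lemma tval_owner_0_test:
  assumes "holds_input s" "nmem s ''j'' 0 = k" "nmem s ''t'' 0 = t" "k < m" "t < m"
  shows "tval owner_0_test s \<longleftrightarrow> owner {j. before j t} k = 0"
  using assms
  by (auto simp: holds_input_def owner_0_test_def owner_def before_test_def contested_test_def
      Let_def contested_def before_def)

lemma place_step:
  assumes inv: "place_inv t k s" and "k < m" "t < m"
  shows "place_inv t (Suc k) (result place_item s)"
proof -
  define c where "c = owner {j. before j t}"
  have input: "holds_input s"
    and nat_cells: "nmem s ''t'' 0 = t" "nmem s ''j'' 0 = k" "nmem s ''found'' 0 = 0"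
    and alloc: "\<forall>j<k. nmem s ''alloc'' j = c j"
    and d: "rmem s ''d0'' 0 = (\<Sum>j\<in>{..<k} - {t}. advantage c 0 j)"
      "rmem s ''d1'' 0 = (\<Sum>j\<in>{..<k} - {t}. advantage c 1 j)"
    using inv by (simp_all add: place_inv_def c_def)
  have v: "rmem s ''u0'' k = v 0 k" "rmem s ''u1'' k = v 1 k"
    using input \<open>k < m\<close> by (simp_all add: holds_input_def)
  have test: "tval owner_0_test s \<longleftrightarrow> c k = 0"
    unfolding c_def by (rule tval_owner_0_test[OF input nat_cells(2,1) assms(2,3)])
  have c: "c k = 0 \<or> c k = 1"
    using less_2_cases[OF owner_less_2] by (simp add: c_def)
  have sums: "(\<Sum>j\<in>{..<Suc k} - {t}. advantage c i j)
      = (\<Sum>j\<in>{..<k} - {t}. advantage c i j) + (if k = t then 0 else advantage c i k)" for i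
    by (simp add: lessThan_Suc insert_Diff_if)
  note cells = result_place_item[OF nat_cells(1,2)]
  have "holds_input (result place_item s)"
    using input by (simp add: holds_input_def cells)
  moreover have "\<forall>j<Suc k. nmem (result place_item s) ''alloc'' j = c j"
    using alloc c by (auto simp: cells test less_Suc_eq)
  moreover have "rmem (result place_item s) ''d0'' 0 = (\<Sum>j\<in>{..<Suc k} - {t}. advantage c 0 j)"
    "rmem (result place_item s) ''d1'' 0 = (\<Sum>j\<in>{..<Suc k} - {t}. advantage c 1 j)"
    unfolding sums using c by (auto simp: cells test d v advantage_def)
  ultimately show ?thesis
    unfolding place_inv_def c_def[symmetric] using \<open>k < m\<close> nat_cells by (simp add: cells)
qed

lemma decide_step:
  assumes inv: "place_inv t m s" and "t < m" and earlier: "\<forall>t'<t. \<not> accept0 t' \<and> \<not> accept1 t'"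
  shows "search_inv (Suc t) (result decide s)"
proof -
  have input: "holds_input s" and st: "nmem s ''t'' 0 = t" "nmem s ''found'' 0 = 0"
    and alloc: "\<forall>j<m. nmem s ''alloc'' j = owner {j. before j t} j"
    and d: "rmem s ''d0'' 0 = rest t 0" "rmem s ''d1'' 0 = rest t 1"
    using inv by (simp_all add: place_inv_def rest_def)
  have v: "rmem s ''u0'' t = v 0 t" "rmem s ''u1'' t = v 1 t"
    using input \<open>t < m\<close> by (simp_all add: holds_input_def)
  have abs_iff: "x + y \<ge> 0 \<or> x - y \<ge> 0 \<longleftrightarrow> x + \<bar>y\<bar> \<ge> 0" for x y :: real
    by linarith
  have con: "tval (contested_test (nvar ''t'')) s \<longleftrightarrow> contested t"
    by (simp add: contested_test_def contested_def st v)
  have t0: "tval (TAnd (nonneg_abs_test (rvar ''d0'') (RCell ''u0'' (nvar ''t'')))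
      (nonneg_test (rvar ''d1''))) s \<longleftrightarrow> accept0 t" if "contested t"
    using that abs_iff[of "rest t 0" "v 0 t"]
    by (simp add: nonneg_abs_test_def nonneg_test_def accept0_def st v d not_less)
  have t1: "tval (TAnd (nonneg_test (rvar ''d0''))
      (nonneg_abs_test (rvar ''d1'') (RCell ''u1'' (nvar ''t'')))) s \<longleftrightarrow> accept1 t" if "contested t"
    using that abs_iff[of "rest t 1" "v 1 t"]
    by (simp add: nonneg_abs_test_def nonneg_test_def accept1_def st v d not_less)
  consider "accept0 t" | "\<not> accept0 t" "accept1 t" | "\<not> accept0 t" "\<not> accept1 t"
    by blast
  then show ?thesis
  proof cases
    case 1
    then have "contested t"
      by (simp add: accept0_def)
    moreover have "fair (nmem s ''alloc'')"
      using fair_accept0[OF \<open>t < m\<close> 1] alloc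
        fair_cong[of "nmem s ''alloc''" "owner {j. before j t}"] by simp
    ultimately show ?thesis
      using 1 input st \<open>t < m\<close> unfolding search_inv_def decide_def
      by (simp add: con t0 holds_input_def del: tval.simps)
  next
    case 2
    then have "contested t"
      by (simp add: accept1_def)
    \<comment> \<open>Moving the contested item \<open>t\<close> into the set exchanges its owner,
      as flipping its entry does.\<close>
    have "((nmem s ''alloc'')(t := 1 - nmem s ''alloc'' t)) j
        = owner (insert t {j. before j t}) j" if "j < m" for j
    proof (cases "j = t")
      case True
      then show ?thesis
        using alloc \<open>t < m\<close> \<open>contested t\<close> by (simp add: owner_def not_before_self)
    next
      case False
      then show ?thesis
        using that alloc owner_cong[of j "{j. before j t}" "insert t {j. before j t}"] by simp
    qed
    then have "fair ((nmem s ''alloc'')(t := 1 - nmem s ''alloc'' t))"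
      using fair_accept1[OF \<open>t < m\<close> 2(2)] fair_cong by blast
    then show ?thesis
      using 2 input st \<open>t < m\<close> \<open>contested t\<close> unfolding search_inv_def decide_def
      by (simp add: con t0 t1 holds_input_def del: tval.simps)
  next
    case 3
    have same: "nmem (result decide s) = (nmem s)(''t'' := (nmem s ''t'')(0 := Suc t))"
      "rmem (result decide s) = rmem s"
      using 3 st unfolding decide_def
      by (cases "contested t"; simp add: con t0 t1 del: tval.simps)+
    show ?thesis
      using 3 input st \<open>t < m\<close> alloc earlier
      by (simp add: search_inv_def holds_input_def same less_Suc_eq)
  qed
qed

lemma search_step:
  assumes inv: "search_inv k s" and test: "tval search_test s"
  shows "k < m \<and> runs try_threshold s (try_time m) (search_inv (Suc k))"
proof -
  have k: "k < m" and found: "nmem s ''found'' 0 = 0"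
    using inv test by (auto simp: search_inv_def search_test_def holds_input_def)
  have earlier: "\<forall>t<k. \<not> accept0 t \<and> \<not> accept1 t"
    using inv found by (simp add: search_inv_def)
  have "loop_free reset" "loop_free place_item" "loop_free decide"
    by (simp_all add: reset_def place_item_def decide_def)
  note run = this[THEN runs_loop_free]
  have init: "place_inv k 0 (result reset s)"
    using inv found k by (simp add: place_inv_def search_inv_def holds_input_def reset_def)
  have place: "runs (While place_test place_item) s'
      (Suc m * (1 + tcost place_test + max_cost place_item)) (place_inv k m)"
    if "place_inv k 0 s'" for s'
  proof (rule runs_mono[OF runs_While[of "place_inv k"]])
    show "i < m \<and> runs place_item s'' (max_cost place_item) (place_inv k (Suc i))"
      if "place_inv k i s''" "tval place_test s''" for i s''
    proof
      show "i < m"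
        using that by (simp add: place_inv_def place_test_def holds_input_def)
      then show "runs place_item s'' (max_cost place_item) (place_inv k (Suc i))"
        by (intro runs_mono[OF run(2)]) (auto intro: place_step that k)
    qed
  \<comment> \<open>On exit the failed test and the bound in the invariant force the counter to be
    \<open>m\<close>.\<close>
  qed (use that in \<open>auto simp: place_inv_def place_test_def holds_input_def\<close>)
  have "runs try_threshold s (try_time m) (search_inv (Suc k))"
    unfolding try_threshold_def try_time_def
  proof (intro runs_Seq)
    show "runs reset s (max_cost reset) (place_inv k 0)"
      by (rule runs_mono[OF run(1)]) (simp_all add: init)
    show "runs decide s' (max_cost decide) (search_inv (Suc k))" if "place_inv k m s'" for s'
      by (rule runs_mono[OF run(3)]) (simp_all add: decide_step that k earlier)
  qed (rule place)
  with k show ?thesis ..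
qed

lemma runs_threshold_search:
  "runs threshold_search (input_state m v) (search_time m) (\<lambda>s. fair (nmem s ''alloc''))"
  unfolding threshold_search_def search_time_def
proof (rule runs_mono[OF runs_While[of search_inv]])
  show "search_inv 0 (input_state m v)"
    by (simp add: search_inv_def holds_input_def input_state_def)
  show "k < m \<and> runs try_threshold s (try_time m) (search_inv (Suc k))"
    if "search_inv k s" "tval search_test s" for k s
    using search_step that .
  show "fair (nmem s ''alloc'')" if "\<exists>k. search_inv k s \<and> \<not> tval search_test s" for s
  proof -
    from that obtain k where inv: "search_inv k s" and stop: "\<not> tval search_test s"
      by blast
    show ?thesis
    proof (cases "nmem s ''found'' 0 = 0")
      case True
      then have "k = m"
        using inv stop by (auto simp: search_inv_def search_test_def holds_input_def)
      \<comment> \<open>All thresholds were refused, which is possible only without contested items;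
        then any placement by \<open>owner\<close> is fair.\<close>
      then have uncontested: "\<not> contested j" if "j < m" for j
        using exists_accepted[OF that] inv True by (auto simp: search_inv_def)
      have "\<forall>j<m. nmem s ''alloc'' j = owner {j. before j (m - 1)} j"
        using inv True \<open>k = m\<close> by (auto simp: search_inv_def)
      then show ?thesis
        using fair_uncontested[OF uncontested] fair_cong by blast
    next
      case False
      then show ?thesis
        using inv by (simp add: search_inv_def)
    qed
  qed
qed simp

section \<open>From owner maps to allocations\<close>

lemma fair_output_allocation:
  fixes N :: "'i set" and Os :: "'o set" and u :: "'i \<Rightarrow> 'o set \<Rightarrow> real"
  assumes Os: "finite Os" and add: "\<forall>i\<in>N. additive_on Os (u i)"
    and agt: "bij_betw agt {..<2} N" and itm: "bij_betw itm {..<m} Os"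
    and v: "v = (\<lambda>k j. u (agt k) {itm j})" and fair: "fair (nmem s ''alloc'')"
  defines "\<pi> \<equiv> output_allocation m agt itm s"
  shows "allocation N Os \<pi> \<and> pareto_optimal N Os u \<pi> \<and> EF1 N u \<pi>"
proof -
  define c where "c = nmem s ''alloc''"
  have c2: "c j < 2" if "j < m" for j
    using fair that by (simp add: fair_def c_def)
  have N: "N = {agt 0, agt 1}"
    using agt by (auto simp: bij_betw_def numeral_2_eq_2 lessThan_Suc)
  have agt_inj: "k < 2 \<Longrightarrow> l < 2 \<Longrightarrow> agt k = agt l \<longleftrightarrow> k = l" for k l
    using agt by (auto simp: bij_betw_def inj_on_def)
  have itm_inj: "i < m \<Longrightarrow> j < m \<Longrightarrow> itm i = itm j \<longleftrightarrow> i = j" for i j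
    using itm by (auto simp: bij_betw_def inj_on_def)
  have Os_eq: "Os = itm ` {..<m}"
    using itm by (simp add: bij_betw_def)
  have \<pi>: "\<pi> (agt k) = itm ` {j. j < m \<and> c j = k}" if "k < 2" for k
    using that c2 agt_inj by (auto simp: \<pi>_def output_allocation_def c_def)
  have alloc: "allocation N Os \<pi>"
  proof -
    have "{..<m} = {j. j < m \<and> c j = 0} \<union> {j. j < m \<and> c j = 1}"
      using c2 by (auto simp: less_2_cases_iff)
    then have "(\<Union>i\<in>N. \<pi> i) = Os"
      unfolding N Os_eq by (simp add: \<pi> image_Un)
    moreover have "\<pi> (agt 0) \<inter> \<pi> (agt 1) = {}"
      using itm_inj by (auto simp: \<pi>)
    ultimately show ?thesis
      unfolding allocation_def N by auto
  qed
  have val: "u (agt k) (itm ` J) = (\<Sum>j\<in>J. v k j)" if "k < 2" "J \<subseteq> {..<m}" for k J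
  proof -
    have "agt k \<in> N"
      using that(1) by (auto simp: N less_2_cases_iff)
    moreover have "itm ` J \<subseteq> Os"
      using that(2) by (auto simp: Os_eq)
    ultimately have "u (agt k) (itm ` J) = (\<Sum>x\<in>itm ` J. u (agt k) {x})"
      using add unfolding additive_on_def by blast
    also have "\<dots> = (\<Sum>j\<in>J. v k j)"
      using that(2) itm_inj by (subst sum.reindex) (auto simp: inj_on_def v subset_eq)
    finally show ?thesis .
  qed
  from fair obtain r where r: "0 < r" "\<And>j. j < m \<Longrightarrow> 0 \<le> advantage c 0 j + r * advantage c 1 j"
    unfolding fair_def c_def by blast
  have "pareto_optimal N Os u \<pi>"
  \<comment> \<open>With these weights, the inequality on \<open>advantage\<close> for an item says
    that its owner values it at least as much as the other agent does.\<close>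
  proof (rule pareto_optimal_if_weighted[where w = "\<lambda>i. if i = agt 0 then 1 else r"])
    show "(if k = agt 0 then 1 else r) * u k {x} \<le> (if i = agt 0 then 1 else r) * u i {x}"
      if ik: "i \<in> N" "k \<in> N" and x: "x \<in> \<pi> i" for i k x
    proof -
      obtain p q where pq: "p < 2" "q < 2" "i = agt p" "k = agt q"
        using ik unfolding N by (metis insertE one_less_numeral_iff pos2 semiring_norm(76) singletonD)
      obtain j where j: "j < m" "c j = p" "x = itm j"
        using x pq \<pi> by auto
      show ?thesis
        using r(2)[OF j(1), unfolded advantage_def] pq agt_inj[of 1 0] j
        by (auto simp: less_2_cases_iff v)
    qed
  qed (use Os alloc add r(1) N in auto)
  moreover have "\<not> envies_by_more_than_one_item u \<pi> (agt k) (agt l)" if kl: "k < 2" "l < 2" for k l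
  proof (cases "k = l")
    case True
    then show ?thesis
      by (simp add: envies_by_more_than_one_item_def envies_def)
  next
    case False
    \<comment> \<open>Additivity turns summed advantages into a difference of bundle values, both
      for all items and for all but one.\<close>
    have diff: "u (agt k) (itm ` {j \<in> J. c j = k}) - u (agt k) (itm ` {j \<in> J. c j = l})
        = (\<Sum>j\<in>J. advantage c k j)" if "J \<subseteq> {..<m}" for J
    proof -
      have "finite J"
        using that finite_subset by blast
      have *: "c j = l \<longleftrightarrow> c j \<noteq> k" if "j \<in> J" for j
        using c2[of j] kl False that \<open>J \<subseteq> {..<m}\<close> by (auto simp: less_2_cases_iff subset_eq)
      have "{j \<in> J. c j = l} = {j \<in> J. c j \<noteq> k}"
        using * by blast
      then show ?thesis
        using that kl \<open>finite J\<close>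
        by (simp add: val subset_eq advantage_def sum.If_cases sum_negf Int_def conj_commute)
    qed
    from fair kl(1) consider "0 \<le> (\<Sum>j<m. advantage c k j)"
      | t where "t < m" "0 \<le> (\<Sum>j\<in>{..<m} - {t}. advantage c k j)"
      unfolding fair_def c_def by blast
    then show ?thesis
    proof cases
      case 1
      then show ?thesis
        using diff[of "{..<m}"] kl
        by (simp add: envies_by_more_than_one_item_def envies_def \<pi>)
    next
      case 2
      have "\<pi> (agt n) - {itm t} = itm ` {j \<in> {..<m} - {t}. c j = n}" if "n < 2" for n
        using that itm_inj 2(1) by (auto simp: \<pi>)
      then have "u (agt k) (\<pi> (agt l) - {itm t}) \<le> u (agt k) (\<pi> (agt k) - {itm t})"
        using diff[of "{..<m} - {t}"] 2(2) kl by auto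
      \<comment> \<open>The two distinct agents share all items, so \<open>t\<close> is in one of
        their bundles and may be removed.\<close>
      moreover have "itm t \<in> \<pi> (agt k) \<union> \<pi> (agt l)"
        using c2[OF 2(1)] 2(1) kl False by (auto simp: \<pi> less_2_cases_iff)
      ultimately show ?thesis
        by (auto simp: envies_by_more_than_one_item_def not_less)
    qed
  qed
  then have "EF1 N u \<pi>"
    unfolding EF1_def N by simp
  ultimately show ?thesis
    using alloc by blast
qed

end

lemma threshold_search_correct:
  fixes N :: "'i set" and Os :: "'o set" and u :: "'i \<Rightarrow> 'o set \<Rightarrow> real"
  assumes "finite Os" "\<forall>i\<in>N. additive_on Os (u i)"
    and "bij_betw agt {..<2} N" "bij_betw itm {..<m} Os"
  shows "\<exists>t s. exec threshold_search (input_state m (\<lambda>k j. u (agt k) {itm j})) t s \<and>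
           t \<le> search_time m \<and>
           (let \<pi> = output_allocation m agt itm s in
              allocation N Os \<pi> \<and> pareto_optimal N Os u \<pi> \<and> EF1 N u \<pi>)"
  using two_agents.runs_threshold_search[of m "\<lambda>k j. u (agt k) {itm j}"]
    two_agents.fair_output_allocation[OF assms refl]
  unfolding runs_def Let_def by blast

theorem theorem2:
  shows "(\<forall>(N :: 'i set) (Os :: 'o set) (u :: 'i \<Rightarrow> 'o set \<Rightarrow> real).
            finite N \<and> card N = 2 \<and> finite Os \<and> (\<forall>i\<in>N. additive_on Os (u i)) \<longrightarrow>
            (\<exists>\<pi>. allocation N Os \<pi> \<and> pareto_optimal N Os u \<pi> \<and> EF1 N u \<pi>))
       \<and> (\<exists>(P :: com) (T :: nat \<Rightarrow> nat).
            (\<lambda>m. real (T m)) \<in> O(\<lambda>m. real m ^ 2) \<and>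
            (\<forall>(N :: 'i set) (Os :: 'o set) (u :: 'i \<Rightarrow> 'o set \<Rightarrow> real) (m :: nat)
               (agt :: nat \<Rightarrow> 'i) (itm :: nat \<Rightarrow> 'o).
               finite N \<and> card N = 2 \<and> finite Os \<and> card Os = m \<and>
               (\<forall>i\<in>N. additive_on Os (u i)) \<and>
               bij_betw agt {..<2} N \<and> bij_betw itm {..<m} Os \<longrightarrow>
               (\<exists>t s. exec P (input_state m (\<lambda>k j. u (agt k) {itm j})) t s \<and> t \<le> T m \<and>
                      (let \<pi> = output_allocation m agt itm s in
                         allocation N Os \<pi> \<and> pareto_optimal N Os u \<pi> \<and> EF1 N u \<pi>))))"
proof (intro conjI)
  show "\<forall>(N :: 'i set) (Os :: 'o set) (u :: 'i \<Rightarrow> 'o set \<Rightarrow> real).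
      finite N \<and> card N = 2 \<and> finite Os \<and> (\<forall>i\<in>N. additive_on Os (u i)) \<longrightarrow>
      (\<exists>\<pi>. allocation N Os \<pi> \<and> pareto_optimal N Os u \<pi> \<and> EF1 N u \<pi>)"
  proof (intro allI impI)
    fix N :: "'i set" and Os :: "'o set" and u :: "'i \<Rightarrow> 'o set \<Rightarrow> real"
    assume *: "finite N \<and> card N = 2 \<and> finite Os \<and> (\<forall>i\<in>N. additive_on Os (u i))"
    \<comment> \<open>Any numbering of agents and items will do; the output of the program is the
      witness.\<close>
    obtain agt :: "nat \<Rightarrow> 'i" where "bij_betw agt {..<2} N"
      using * ex_bij_betw_nat_finite[of N] by (auto simp: atLeast0LessThan)
    moreover obtain itm :: "nat \<Rightarrow> 'o" where "bij_betw itm {..<card Os} Os"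
      using * ex_bij_betw_nat_finite[of Os] by (auto simp: atLeast0LessThan)
    ultimately show "\<exists>\<pi>. allocation N Os \<pi> \<and> pareto_optimal N Os u \<pi> \<and> EF1 N u \<pi>"
      using * threshold_search_correct[of Os N u agt itm "card Os"] unfolding Let_def by blast
  qed
qed (rule exI[of _ threshold_search], rule exI[of _ search_time],
    use search_time_bigo threshold_search_correct in blast)

end
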